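(* Consider an arbitrary compound channel with uncertainty set $\mathcal{S}$ and a sequence of $(n,r_n,\varepsilon_n)$-codes for it such that $$\lim_{n\to\infty}\varepsilon_n=0,\qquad\lim_{n\to\infty}r_n=R.$$ If the input $X^n$ is uniformly distributed over the codewords, then the induced information density rate $\frac1n i(X^n;Y^n|s)$ converges in probability to the code rate $R$ uniformly over the whole class of channels: $$\lim_{n\to\infty}\sup_{s\in\mathcal{S}}\Pr\{|\tfrac1n i(X^n;Y^n|s)-R|>\delta\}=0\quad\forall\delta>0,$$ so that $$\underline{\underline{I}}(\boldsymbol{X},\boldsymbol{Y})=\overline{\overline{I}}(\boldsymbol{X},\boldsymbol{Y})=\lim_{n\to\infty}\frac1n I(X^n;Y^n|s)=R\quad\forall s\in\mathcal{S}.$$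
   Context: A compound channel is, for each blocklength $n$ and each state $s$ in an arbitrary set $\mathcal{S}$, a transition probability $p_s(y^n|x^n)$ (no stationarity, ergodicity or information stability; arbitrary alphabets). An $(n,r_n,\varepsilon_n)$-code has $M_n$ codewords of length $n$ not depending on $s$, decision regions which may depend on $s$ (the receiver knows $s$), rate $r_n=\frac1n\ln M_n$, and compound error probability $\varepsilon_n=\sup_{s\in\mathcal{S}}\varepsilon_{ns}$, where $\varepsilon_{ns}$ is the (maximum or average) error probability under state $s$. For an input $\boldsymbol{X}=\{X^n\}$ not depending on $s$, with output $Y^n$ of distribution $p_s(y^n)$ under state $s$, let $i(x^n;y^n|s)=\ln\frac{p_s(y^n|x^n)}{p_s(y^n)}$, $Z_{ns}=\frac1n i(X^n;Y^n|s)$, $I(X^n;Y^n|s)=E\{i(X^n;Y^n|s)\}$ and $$\underline{\underline{I}}(\boldsymbol{X},\boldsymbol{Y})=\sup\{R:\lim_{n\to\infty}\sup_s\Pr\{Z_{ns}\le R\}=0\},\quad \overline{\overline{I}}(\boldsymbol{X},\boldsymbol{Y})=\inf\{R:\lim_{n\to\infty}\sup_s\Pr\{Z_{ns}\ge R\}=0\}.$$ *)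

theory Defs
  imports "HOL-Probability.Probability"
begin

section \<open>Compound channels\<close>

abbreviation words :: "'a measure \<Rightarrow> nat \<Rightarrow> (nat \<Rightarrow> 'a) measure" where
  "words A n \<equiv> PiM {..<n} (\<lambda>_. A)"

text \<open>\<open>W n s x\<close> is the law of the output word under state \<open>s\<close> when \<open>x\<close> is sent. Nothing relates
  the kernels for different blocklengths or different states.\<close>

definition compound_channel ::
    "'a measure \<Rightarrow> 'b measure \<Rightarrow> 's set \<Rightarrow>
      (nat \<Rightarrow> 's \<Rightarrow> (nat \<Rightarrow> 'a) \<Rightarrow> (nat \<Rightarrow> 'b) measure) \<Rightarrow> bool" where
  "compound_channel A B S W \<longleftrightarrow>
     (\<forall>n>0. \<forall>s\<in>S. W n s \<in> words A n \<rightarrow>\<^sub>M prob_algebra (words B n))"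


section \<open>Codes\<close>

text \<open>Messages are \<open>{..<num_codewords C}\<close>. Codewords do not depend on the state, decision regions
  may. Codewords of different messages are not required to differ.\<close>

record ('s, 'a, 'b) block_code =
  num_codewords :: nat
  codeword :: "nat \<Rightarrow> nat \<Rightarrow> 'a"
  decision_region :: "'s \<Rightarrow> nat \<Rightarrow> (nat \<Rightarrow> 'b) set"

definition is_code ::
    "'a measure \<Rightarrow> 'b measure \<Rightarrow> 's set \<Rightarrow> nat \<Rightarrow> ('s, 'a, 'b) block_code \<Rightarrow> bool" where
  "is_code A B S n C \<longleftrightarrow>
     num_codewords C \<ge> 1 \<and>
     (\<forall>m<num_codewords C. codeword C m \<in> space (words A n)) \<and>
     (\<forall>s\<in>S. (\<forall>m<num_codewords C. decision_region C s m \<in> sets (words B n)) \<and>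
            disjoint_family_on (decision_region C s) {..<num_codewords C})"

definition code_rate :: "nat \<Rightarrow> ('s, 'a, 'b) block_code \<Rightarrow> real" where
  "code_rate n C = ln (real (num_codewords C)) / real n"

definition message_error ::
    "('s \<Rightarrow> (nat \<Rightarrow> 'a) \<Rightarrow> (nat \<Rightarrow> 'b) measure) \<Rightarrow> ('s, 'a, 'b) block_code \<Rightarrow> 's \<Rightarrow> nat \<Rightarrow> real" where
  "message_error K C s m =
     measure (K s (codeword C m)) (space (K s (codeword C m)) - decision_region C s m)"

datatype error_criterion = Maximum_Error | Average_Error

fun state_error ::
    "error_criterion \<Rightarrow> ('s \<Rightarrow> (nat \<Rightarrow> 'a) \<Rightarrow> (nat \<Rightarrow> 'b) measure) \<Rightarrow>
      ('s, 'a, 'b) block_code \<Rightarrow> 's \<Rightarrow> real" where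
  "state_error Maximum_Error K C s = (MAX m\<in>{..<num_codewords C}. message_error K C s m)"
| "state_error Average_Error K C s =
     (\<Sum>m<num_codewords C. message_error K C s m) / real (num_codewords C)"

definition compound_error ::
    "error_criterion \<Rightarrow> 's set \<Rightarrow> ('s \<Rightarrow> (nat \<Rightarrow> 'a) \<Rightarrow> (nat \<Rightarrow> 'b) measure) \<Rightarrow>
      ('s, 'a, 'b) block_code \<Rightarrow> real" where
  "compound_error crit S K C = (SUP s\<in>S. state_error crit K C s)"

definition code_input :: "'a measure \<Rightarrow> nat \<Rightarrow> ('s, 'a, 'b) block_code \<Rightarrow> (nat \<Rightarrow> 'a) measure" where
  "code_input A n C =
     distr (uniform_count_measure {..<num_codewords C}) (words A n) (codeword C)"


section \<open>Information density\<close>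

text \<open>For an input law \<open>P\<close> and a kernel \<open>K\<close>, the output law is \<open>P \<bind> K\<close>.\<close>

definition joint_law :: "'x measure \<Rightarrow> ('x \<Rightarrow> 'y measure) \<Rightarrow> ('x \<times> 'y) measure" where
  "joint_law P K = P \<bind> (\<lambda>x. distr (K x) (P \<Otimes>\<^sub>M (P \<bind> K)) (Pair x))"

text \<open>On arbitrary alphabets the likelihood ratio \<open>p(y|x) / p(y)\<close> is the Radon-Nikodym derivative
  \<open>dP\<^sub>X\<^sub>Y / d(P\<^sub>X \<times> P\<^sub>Y)\<close>, which unlike a separate choice of \<open>dP\<^sub>Y\<^sub>|\<^sub>x / dP\<^sub>Y\<close> for every \<open>x\<close> is jointly
  measurable. The two lemmas below recover the expression by conditional laws and, for channels
  with a transition density (pmf or pdf), the elementary quotient. The convention \<open>ln 0 = 0\<close> only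
  matters on a null set of the joint law.\<close>

definition info_density :: "'x measure \<Rightarrow> ('x \<Rightarrow> 'y measure) \<Rightarrow> 'x \<times> 'y \<Rightarrow> real" where
  "info_density P K z =
     ln (enn2real (RN_deriv (P \<Otimes>\<^sub>M (P \<bind> K)) (joint_law P K) z))"

definition mutual_info :: "'x measure \<Rightarrow> ('x \<Rightarrow> 'y measure) \<Rightarrow> real" where
  "mutual_info P K = (\<integral>z. info_density P K z \<partial>joint_law P K)"

lemma emeasure_joint_law:
  assumes P: "P \<in> space (prob_algebra A)" and K: "K \<in> A \<rightarrow>\<^sub>M prob_algebra B"
    and E: "E \<in> sets (A \<Otimes>\<^sub>M B)"
  shows "emeasure (joint_law P K) E = (\<integral>\<^sup>+x. emeasure (K x) (Pair x -` E) \<partial>P)"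
    and "sets (joint_law P K) = sets (A \<Otimes>\<^sub>M B)"
    and "prob_space (P \<bind> K)" and "sets (P \<bind> K) = sets B"
proof -
  interpret P: prob_space P using P by (simp add: space_prob_algebra)
  have sP[measurable_cong, simp]: "sets P = sets A" using P by (simp add: space_prob_algebra)
  have K'[measurable]: "K \<in> P \<rightarrow>\<^sub>M prob_algebra B" using K by (simp cong: measurable_cong_sets)
  have PK: "P \<bind> K \<in> space (prob_algebra B)"
    using measurable_bind_prob_space[OF measurable_const, OF P K, THEN measurable_space,
        of undefined "count_space UNIV"] by simp
  show "prob_space (P \<bind> K)" and sY[measurable_cong, simp]: "sets (P \<bind> K) = sets B"
    using PK by (simp_all add: space_prob_algebra)
  have sXY[measurable_cong, simp]: "sets (P \<Otimes>\<^sub>M (P \<bind> K)) = sets (A \<Otimes>\<^sub>M B)"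
    by (intro sets_pair_measure_cong) auto
  have sK: "sets (K x) = sets B" if "x \<in> space P" for x
    using measurable_space[OF K' that] by (simp add: space_prob_algebra)
  let ?k = "\<lambda>x. distr (K x) (P \<Otimes>\<^sub>M (P \<bind> K)) (Pair x)"
  have m: "?k \<in> P \<rightarrow>\<^sub>M subprob_algebra (P \<Otimes>\<^sub>M (P \<bind> K))"
    by (rule measurable_distr2[OF _ measurable_prob_algebraD[OF K']]) simp
  show "sets (joint_law P K) = sets (A \<Otimes>\<^sub>M B)"
    unfolding joint_law_def using sets_bind_measurable[OF m P.not_empty] by simp
  show "emeasure (joint_law P K) E = (\<integral>\<^sup>+x. emeasure (K x) (Pair x -` E) \<partial>P)"
    unfolding joint_law_def
  proof (subst emeasure_bind[OF P.not_empty m], use E in simp, rule nn_integral_cong)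
    fix x assume x: "x \<in> space P"
    then have "Pair x \<in> K x \<rightarrow>\<^sub>M A \<Otimes>\<^sub>M B"
      using sK[OF x] sets_eq_imp_space_eq[OF sP] by (simp cong: measurable_cong_sets)
    then have "Pair x \<in> K x \<rightarrow>\<^sub>M P \<Otimes>\<^sub>M (P \<bind> K)"
      by (simp cong: measurable_cong_sets)
    moreover have "Pair x -` E \<subseteq> space (K x)"
      using sets.sets_into_space[OF E] sets_eq_imp_space_eq[OF sK[OF x]]
      by (auto simp: space_pair_measure)
    ultimately show "emeasure (?k x) E = emeasure (K x) (Pair x -` E)"
      using E by (subst emeasure_distr) (auto simp: Int_absorb2)
  qed
qed

lemma info_density_conditional:
  assumes P: "P \<in> space (prob_algebra A)" and K: "K \<in> A \<rightarrow>\<^sub>M prob_algebra B"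
    and k: "k \<in> borel_measurable (A \<Otimes>\<^sub>M B)"
    and dens: "AE x in P. K x = density (P \<bind> K) (\<lambda>y. k (x, y))"
  shows "AE z in joint_law P K. info_density P K z = ln (enn2real (k z))"
proof -
  note [measurable] = k
  note J = emeasure_joint_law[OF P K]
  have sP[measurable_cong, simp]: "sets P = sets A" using P by (simp add: space_prob_algebra)
  have sY[measurable_cong, simp]: "sets (P \<bind> K) = sets B" using J(4)[OF sets.empty_sets] .
  interpret X: prob_space P using P by (simp add: space_prob_algebra)
  interpret Y: prob_space "P \<bind> K" using J(3)[OF sets.empty_sets] .
  interpret XY: pair_prob_space P "P \<bind> K" ..
  have sXY[measurable_cong, simp]: "sets (P \<Otimes>\<^sub>M (P \<bind> K)) = sets (A \<Otimes>\<^sub>M B)"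
    by (intro sets_pair_measure_cong) auto
  have eq: "density (P \<Otimes>\<^sub>M (P \<bind> K)) k = joint_law P K"
  proof (rule measure_eqI)
    show "sets (density (P \<Otimes>\<^sub>M (P \<bind> K)) k) = sets (joint_law P K)"
      using J(2)[OF sets.empty_sets] by simp
    fix E assume "E \<in> sets (density (P \<Otimes>\<^sub>M (P \<bind> K)) k)"
    then have E[measurable]: "E \<in> sets (A \<Otimes>\<^sub>M B)" by simp
    have "emeasure (density (P \<Otimes>\<^sub>M (P \<bind> K)) k) E =
        (\<integral>\<^sup>+z. k z * indicator E z \<partial>(P \<Otimes>\<^sub>M (P \<bind> K)))"
      by (subst emeasure_density) (auto simp: cong: measurable_cong_sets)
    also have "\<dots> = (\<integral>\<^sup>+x. \<integral>\<^sup>+y. k (x, y) * indicator E (x, y) \<partial>(P \<bind> K) \<partial>P)"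
      by (subst Y.nn_integral_fst[symmetric]) auto
    also have "\<dots> = (\<integral>\<^sup>+x. emeasure (K x) (Pair x -` E) \<partial>P)"
    proof (rule nn_integral_cong_AE)
      show "AE x in P. (\<integral>\<^sup>+y. k (x, y) * indicator E (x, y) \<partial>(P \<bind> K)) =
          emeasure (K x) (Pair x -` E)"
        using dens AE_space
      proof eventually_elim
        case (elim x)
        have x[measurable]: "x \<in> space A" using elim(2) sets_eq_imp_space_eq[OF sP] by simp
        have [measurable]: "Pair x -` E \<in> sets (P \<bind> K)" using sets_Pair1[OF E] by simp
        have [measurable]: "(\<lambda>y. k (x, y)) \<in> borel_measurable (P \<bind> K)" by measurable
        show ?case
          by (subst elim(1), subst emeasure_density)
            (auto intro!: nn_integral_cong simp: indicator_def)
      qed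
    qed
    finally show "emeasure (density (P \<Otimes>\<^sub>M (P \<bind> K)) k) E = emeasure (joint_law P K) E"
      using J(1)[OF E] by simp
  qed
  have kM: "k \<in> borel_measurable (P \<Otimes>\<^sub>M (P \<bind> K))"
    by (simp cong: measurable_cong_sets)
  have "AE z in P \<Otimes>\<^sub>M (P \<bind> K). k z = RN_deriv (P \<Otimes>\<^sub>M (P \<bind> K)) (joint_law P K) z"
    using XY.RN_deriv_unique[OF kM eq] .
  then have "AE z in density (P \<Otimes>\<^sub>M (P \<bind> K)) k.
      k z = RN_deriv (P \<Otimes>\<^sub>M (P \<bind> K)) (joint_law P K) z"
    by (subst AE_density[OF kM]) auto
  then show ?thesis unfolding eq by (auto simp: info_density_def)
qed

lemma info_density_transition_density:
  assumes P: "P \<in> space (prob_algebra A)" and K: "K \<in> A \<rightarrow>\<^sub>M prob_algebra B"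
    and nu: "sigma_finite_measure \<nu>" "sets \<nu> = sets B"
    and p: "p \<in> borel_measurable (A \<Otimes>\<^sub>M B)"
    and dens: "\<And>x. x \<in> space A \<Longrightarrow> K x = density \<nu> (\<lambda>y. p (x, y))"
  shows "AE (x, y) in joint_law P K.
    info_density P K (x, y) = ln (enn2real (p (x, y) / (\<integral>\<^sup>+x'. p (x', y) \<partial>P)))"
proof -
  note [measurable] = p
  note [measurable_cong, simp] = nu(2)
  note J = emeasure_joint_law[OF P K]
  have sP[measurable_cong, simp]: "sets P = sets A" using P by (simp add: space_prob_algebra)
  have spP[simp]: "space P = space A" by (rule sets_eq_imp_space_eq) simp
  have sY[measurable_cong, simp]: "sets (P \<bind> K) = sets B" using J(4)[OF sets.empty_sets] .
  interpret X: prob_space P using P by (simp add: space_prob_algebra)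
  interpret nu: sigma_finite_measure \<nu> by fact
  interpret Y: prob_space "P \<bind> K" using J(3)[OF sets.empty_sets] .
  interpret XN: pair_sigma_finite P \<nu> ..
  have K': "K \<in> P \<rightarrow>\<^sub>M subprob_algebra B"
    using measurable_prob_algebraD[OF K] by (simp cong: measurable_cong_sets)
  define q where "q y = (\<integral>\<^sup>+x'. p (x', y) \<partial>P)" for y
  have [measurable]: "q \<in> borel_measurable B" unfolding q_def by measurable
  have Yq: "P \<bind> K = density \<nu> q"
  proof (rule measure_eqI)
    fix E assume "E \<in> sets (P \<bind> K)"
    then have [measurable]: "E \<in> sets B" by simp
    have "emeasure (P \<bind> K) E = (\<integral>\<^sup>+x. emeasure (K x) E \<partial>P)"
      by (rule emeasure_bind[OF X.not_empty K']) simp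
    also have "\<dots> = (\<integral>\<^sup>+x. \<integral>\<^sup>+y. p (x, y) * indicator E y \<partial>\<nu> \<partial>P)"
      by (intro nn_integral_cong) (simp add: dens emeasure_density)
    also have "\<dots> = (\<integral>\<^sup>+y. \<integral>\<^sup>+x. p (x, y) * indicator E y \<partial>P \<partial>\<nu>)"
      by (rule XN.Fubini'[symmetric]) measurable
    also have "\<dots> = (\<integral>\<^sup>+y. q y * indicator E y \<partial>\<nu>)"
      by (intro nn_integral_cong) (auto simp: q_def indicator_def)
    finally show "emeasure (P \<bind> K) E = emeasure (density \<nu> q) E"
      by (simp add: emeasure_density)
  qed simp
  have fin: "AE y in \<nu>. q y \<noteq> \<infinity>"
  proof (rule nn_integral_PInf_AE)
    have "emeasure (P \<bind> K) (space (P \<bind> K)) = (\<integral>\<^sup>+y. q y * indicator (space \<nu>) y \<partial>\<nu>)"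
      unfolding Yq using sets.top[of \<nu>] by (subst emeasure_density) auto
    also have "\<dots> = (\<integral>\<^sup>+y. q y \<partial>\<nu>)" by (intro nn_integral_cong) auto
    finally show "(\<integral>\<^sup>+y. q y \<partial>\<nu>) \<noteq> \<infinity>"
      by (metis Y.emeasure_space_1 ennreal_one_neq_top infinity_ennreal_def)
  qed simp
  have "AE y in \<nu>. AE x in P. q y = 0 \<longrightarrow> p (x, y) = 0"
  proof (rule AE_I2)
    fix y assume [measurable]: "y \<in> space \<nu>"
    then have [measurable]: "y \<in> space B" by (metis nu(2) sets_eq_imp_space_eq)
    show "AE x in P. q y = 0 \<longrightarrow> p (x, y) = 0"
      by (cases "q y = 0") (auto simp: q_def nn_integral_0_iff_AE)
  qed
  then have zero: "AE x in P. AE y in \<nu>. q y = 0 \<longrightarrow> p (x, y) = 0"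
    by (subst XN.AE_commute) measurable
  have "AE x in P. K x = density (P \<bind> K) (\<lambda>y. (\<lambda>(x, y). p (x, y) / q y) (x, y))"
    using zero AE_space
  proof eventually_elim
    case (elim x)
    then have [measurable]: "x \<in> space A" by simp
    have "AE y in \<nu>. p (x, y) = q y * (p (x, y) / q y)"
      using elim(1) fin
      by eventually_elim (auto simp: ennreal_times_divide mult_divide_eq_ennreal mult.commute[of "q _"])
    then have "density \<nu> (\<lambda>y. p (x, y)) = density \<nu> (\<lambda>y. q y * (p (x, y) / q y))"
      by (intro density_cong) measurable
    also have "\<dots> = density (P \<bind> K) (\<lambda>y. p (x, y) / q y)"
      unfolding Yq by (rule density_density_eq[symmetric]) measurable
    finally show ?case using elim(2) by (simp add: dens)
  qed
  from info_density_conditional[OF P K _ this] show ?thesis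
    by (auto simp: q_def split_beta)
qed


section \<open>Information rates of an input process\<close>

context
  fixes S :: "'s set" and P :: "nat \<Rightarrow> 'x measure" and W :: "nat \<Rightarrow> 's \<Rightarrow> 'x \<Rightarrow> 'y measure"
begin

definition info_density_prob :: "nat \<Rightarrow> 's \<Rightarrow> (real \<Rightarrow> bool) \<Rightarrow> real" where
  "info_density_prob n s Q =
     measure (joint_law (P n) (W n s))
       {z \<in> space (joint_law (P n) (W n s)). Q (info_density (P n) (W n s) z / real n)}"

definition inf_info_rate :: ereal where
  "inf_info_rate =
     (SUP R\<in>{R::real. (\<lambda>n. SUP s\<in>S. info_density_prob n s (\<lambda>Z. Z \<le> R)) \<longlonglongrightarrow> 0}. ereal R)"

definition sup_info_rate :: ereal where
  "sup_info_rate =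
     (INF R\<in>{R::real. (\<lambda>n. SUP s\<in>S. info_density_prob n s (\<lambda>Z. Z \<ge> R)) \<longlonglongrightarrow> 0}. ereal R)"

end

end

(* For the uniform input over M codewords every conditional law is at most M times the output law,
   so the joint law has density at most M with respect to the product of its marginals and the
   information density never exceeds ln M. Conversely (Verdu-Han), where the density is at most
   M exp (- g), the correctly decoded part has probability at most exp (- g), because the decision
   regions are disjoint; hence the information density is at most ln M - g with probability at most
   the error plus exp (- g). Both bounds are uniform in the state. For the expectations one uses in
   addition that the negative part of the information density has mean at most 1, since
   t ln (1/t) <= 1. *)

theory Submission
  imports Defs "HOL-Real_Asymp.Real_Asymp"
begin

section \<open>Uniform input over a codebook, at one blocklength and in one state\<close>

text \<open>The values \<open>x m\<close> may coincide, and a repeated codeword then carries a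
  multiple of the mass \<open>1 / M\<close>. Sums therefore run over messages, not over the set of
  codewords.\<close>

locale uniform_input =
  fixes X :: "'x measure" and Y :: "'y measure" and M :: nat
    and x :: "nat \<Rightarrow> 'x" and K :: "'x \<Rightarrow> 'y measure"
  assumes M_pos: "0 < M"
    and x: "\<And>m. m < M \<Longrightarrow> x m \<in> space X"
    and K: "K \<in> X \<rightarrow>\<^sub>M prob_algebra Y"
begin

definition in_law :: "'x measure" where
  "in_law = distr (uniform_count_measure {..<M}) X x"

abbreviation "out_law \<equiv> in_law \<bind> K"
abbreviation "joint \<equiv> joint_law in_law K"
abbreviation "prod_law \<equiv> in_law \<Otimes>\<^sub>M out_law"
abbreviation "ratio \<equiv> RN_deriv prod_law joint"
abbreviation "dens \<equiv> info_density in_law K"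

lemma measurable_x: "x \<in> uniform_count_measure {..<M} \<rightarrow>\<^sub>M X"
  using x by (auto simp: measurable_def space_uniform_count_measure sets_uniform_count_measure)

lemma nn_integral_in_law:
  assumes "h \<in> borel_measurable X"
  shows "(\<integral>\<^sup>+z. h z \<partial>in_law) = (\<Sum>m<M. ennreal (1 / M) * h (x m))"
  unfolding in_law_def
  by (subst nn_integral_distr[OF measurable_x])
    (use assms in \<open>simp_all add: uniform_count_measure_def nn_integral_point_measure_finite\<close>)

lemma sets_in_law [simp, measurable_cong]: "sets in_law = sets X"
  by (simp add: in_law_def)

lemma space_in_law [simp]: "space in_law = space X"
  by (simp add: in_law_def)

sublocale in_law: prob_space in_law
  unfolding in_law_def using M_pos
  by (intro prob_space.prob_space_distr[OF _ measurable_x] prob_space_uniform_count_measure)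
    (auto intro: exI[of _ 0])

lemma in_law: "in_law \<in> space (prob_algebra X)"
  by (simp add: space_prob_algebra in_law.prob_space_axioms)

lemma sets_out_law [simp, measurable_cong]: "sets out_law = sets Y"
  using emeasure_joint_law(4)[OF in_law K sets.empty_sets] .

lemma space_out_law [simp]: "space out_law = space Y"
  by (rule sets_eq_imp_space_eq) simp

sublocale out_law: prob_space out_law
  using emeasure_joint_law(3)[OF in_law K sets.empty_sets] .

sublocale prod_law: pair_prob_space in_law out_law ..

lemma sets_prod_law [simp, measurable_cong]: "sets prod_law = sets (X \<Otimes>\<^sub>M Y)"
  by (intro sets_pair_measure_cong) auto

lemma space_prod_law [simp]: "space prod_law = space (X \<Otimes>\<^sub>M Y)"
  by (rule sets_eq_imp_space_eq) simp

lemma sets_joint [simp, measurable_cong]: "sets joint = sets (X \<Otimes>\<^sub>M Y)"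
  using emeasure_joint_law(2)[OF in_law K sets.empty_sets] .

lemma space_joint [simp]: "space joint = space (X \<Otimes>\<^sub>M Y)"
  by (rule sets_eq_imp_space_eq) simp

lemma
  assumes "z \<in> space X"
  shows prob_space_K: "prob_space (K z)" and sets_K: "sets (K z) = sets Y"
    and space_K: "space (K z) = space Y"
  using measurable_space[OF K assms] by (auto simp: space_prob_algebra dest: sets_eq_imp_space_eq)

lemma emeasure_K_measurable:
  "F \<in> sets Y \<Longrightarrow> (\<lambda>z. emeasure (K z) F) \<in> borel_measurable X"
  using measurable_emeasure_kernel[OF measurable_prob_algebraD[OF K]] .

lemma emeasure_out_law:
  assumes F: "F \<in> sets Y"
  shows "emeasure out_law F = (\<Sum>m<M. ennreal (1 / M) * emeasure (K (x m)) F)"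
proof -
  have "emeasure out_law F = (\<integral>\<^sup>+z. emeasure (K z) F \<partial>in_law)"
    using measurable_prob_algebraD[OF K] F
    by (intro emeasure_bind[OF in_law.not_empty]) (auto cong: measurable_cong_sets)
  then show ?thesis using nn_integral_in_law[OF emeasure_K_measurable[OF F]] by simp
qed

lemma emeasure_joint:
  assumes [measurable]: "E \<in> sets (X \<Otimes>\<^sub>M Y)"
  shows "emeasure joint E = (\<Sum>m<M. ennreal (1 / M) * emeasure (K (x m)) (Pair (x m) -` E))"
proof -
  \<comment> \<open>Writing \<open>E\<close> as the union of its sections brings it into the form in
    which measurability of a kernel on sections is available.\<close>
  have "(SIGMA z:space X. Pair z -` E) = E"
    using sets.sets_into_space[OF assms] by (auto simp: space_pair_measure)
  then have "(\<lambda>z. emeasure (K z) (Pair z -` E)) \<in> borel_measurable X"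
    using assms
    by (intro emeasure_measurable_subprob_algebra2[OF _ measurable_prob_algebraD[OF K]]) simp
  then show ?thesis
    using nn_integral_in_law emeasure_joint_law(1)[OF in_law K assms] by simp
qed

lemma emeasure_K_eq_measure:
  "m < M \<Longrightarrow> emeasure (K (x m)) F = ennreal (measure (K (x m)) F)"
  using prob_space_K[OF x] by (intro finite_measure.emeasure_eq_measure prob_space.axioms)

sublocale joint: prob_space joint
proof
  have "emeasure joint (space joint) =
      (\<Sum>m<M. ennreal (1 / M) * emeasure (K (x m)) (Pair (x m) -` space (X \<Otimes>\<^sub>M Y)))"
    by (simp add: emeasure_joint)
  also have "\<dots> = (\<Sum>m<M. ennreal (1 / M))"
  proof (rule sum.cong)
    fix m assume "m \<in> {..<M}"
    then have m: "x m \<in> space X" using x by simp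
    then have "Pair (x m) -` space (X \<Otimes>\<^sub>M Y) = space (K (x m))"
      by (auto simp: space_pair_measure space_K)
    then show "ennreal (1 / M) * emeasure (K (x m)) (Pair (x m) -` space (X \<Otimes>\<^sub>M Y)) =
        ennreal (1 / M)"
      using prob_space.emeasure_space_1[OF prob_space_K[OF m]] by simp
  qed simp
  also have "\<dots> = 1" using M_pos by (subst sum_ennreal) auto
  finally show "emeasure joint (space joint) = 1" .
qed

lemma measure_joint:
  assumes "E \<in> sets (X \<Otimes>\<^sub>M Y)"
  shows "measure joint E = (\<Sum>m<M. measure (K (x m)) (Pair (x m) -` E)) / M"
proof -
  have "ennreal (measure joint E) =
      (\<Sum>m<M. ennreal (1 / M) * emeasure (K (x m)) (Pair (x m) -` E))"
    using emeasure_joint[OF assms] by (simp add: joint.emeasure_eq_measure)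
  also have "\<dots> = (\<Sum>m<M. ennreal (measure (K (x m)) (Pair (x m) -` E) / M))"
    by (rule sum.cong) (auto simp: emeasure_K_eq_measure simp flip: ennreal_mult)
  finally show ?thesis
    by (simp add: sum_nonneg sum_divide_distrib)
qed

lemma nn_integral_prod_law:
  assumes [measurable]: "h \<in> borel_measurable (X \<Otimes>\<^sub>M Y)"
  shows "(\<integral>\<^sup>+z. h z \<partial>prod_law) = (\<Sum>m<M. ennreal (1 / M) * (\<integral>\<^sup>+y. h (x m, y) \<partial>out_law))"
  by (subst out_law.nn_integral_fst[symmetric]) (auto intro!: nn_integral_in_law)

section \<open>Domination of the joint law by the product of its marginals\<close>

text \<open>The output law is the average of the conditional laws; keeping a single term of this
  average leaves the factor \<open>1 / M\<close>.\<close>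

lemma K_le_out_law:
  assumes "m < M" "F \<in> sets Y"
  shows "emeasure (K (x m)) F \<le> of_nat M * emeasure out_law F"
proof -
  have "emeasure (K (x m)) F = of_nat M * (ennreal (1 / M) * emeasure (K (x m)) F)"
    using M_pos by (simp add: mult.assoc[symmetric] ennreal_of_nat_eq_real_of_nat flip: ennreal_mult)
  also have "\<dots> \<le> of_nat M * emeasure out_law F"
    unfolding emeasure_out_law[OF assms(2)] using assms(1)
    by (intro mult_left_mono member_le_sum) auto
  finally show ?thesis .
qed

text \<open>Averages \<open>K_le_out_law\<close> over the messages, section by section. This
  domination yields both the existence of the likelihood ratio and its bound.\<close>

lemma joint_le_prod_law:
  assumes [measurable]: "E \<in> sets (X \<Otimes>\<^sub>M Y)"
  shows "emeasure joint E \<le> of_nat M * emeasure prod_law E"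
proof -
  have "emeasure prod_law E = (\<integral>\<^sup>+z. indicator E z \<partial>prod_law)" by simp
  also have "\<dots> = (\<Sum>m<M. ennreal (1 / M) * (\<integral>\<^sup>+y. indicator E (x m, y) \<partial>out_law))"
    by (rule nn_integral_prod_law) simp
  also have "\<dots> = (\<Sum>m<M. ennreal (1 / M) * emeasure out_law (Pair (x m) -` E))"
  proof (intro sum.cong refl arg_cong2[where f = "(*)"])
    fix m
    have "(\<lambda>y. indicator E (x m, y) :: ennreal) = indicator (Pair (x m) -` E)"
      by (auto simp: indicator_def)
    then show "(\<integral>\<^sup>+y. indicator E (x m, y) \<partial>out_law) = emeasure out_law (Pair (x m) -` E)"
      using sets_Pair1[OF assms] by (simp cong: measurable_cong_sets)
  qed
  finally have prod: "emeasure prod_law E =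
      (\<Sum>m<M. ennreal (1 / M) * emeasure out_law (Pair (x m) -` E))" .
  have "emeasure joint E \<le>
      (\<Sum>m<M. ennreal (1 / M) * (of_nat M * emeasure out_law (Pair (x m) -` E)))"
    unfolding emeasure_joint[OF assms]
    by (intro sum_mono mult_left_mono K_le_out_law sets_Pair1[OF assms]) auto
  also have "\<dots> = of_nat M * emeasure prod_law E"
    by (simp add: prod sum_distrib_left mult.left_commute)
  finally show ?thesis .
qed

section \<open>The likelihood ratio as a density of the joint law and of the conditional
  laws\<close>

lemma density_ratio: "density prod_law ratio = joint"
proof (rule prod_law.density_RN_deriv)
  show "absolutely_continuous prod_law joint"
    using joint_le_prod_law by (fastforce simp: absolutely_continuous_def null_sets_def)
qed simp

lemma ratio_measurable [measurable]: "ratio \<in> borel_measurable (X \<Otimes>\<^sub>M Y)"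
  using borel_measurable_RN_deriv[of prod_law joint] by (simp cong: measurable_cong_sets)

lemma dens_measurable [measurable]: "dens \<in> borel_measurable (X \<Otimes>\<^sub>M Y)"
  unfolding info_density_def[abs_def] by measurable

text \<open>On the set \<open>E\<close> where the bound fails, the excess of the ratio over
  \<open>M\<close> integrates to 0 by domination, so it vanishes almost everywhere.\<close>

lemma AE_ratio_le: "AE z in prod_law. ratio z \<le> of_nat M"
proof -
  define E where "E = {z \<in> space (X \<Otimes>\<^sub>M Y). of_nat M < ratio z}"
  have E [measurable]: "E \<in> sets (X \<Otimes>\<^sub>M Y)" unfolding E_def by measurable
  \<comment> \<open>The subtracted integral has to be finite for the integral of the difference to
    split.\<close>
  have fin: "(\<integral>\<^sup>+z. of_nat M * indicator E z \<partial>prod_law) \<noteq> \<infinity>"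
    by (subst nn_integral_cmult_indicator)
      (auto simp: ennreal_mult_eq_top_iff)
  have "(\<integral>\<^sup>+z. ratio z * indicator E z - of_nat M * indicator E z \<partial>prod_law) =
      emeasure joint E - of_nat M * emeasure prod_law E"
  proof (subst nn_integral_diff[OF _ _ fin])
    show "AE z in prod_law. of_nat M * indicator E z \<le> ratio z * indicator E z"
      by (auto simp: E_def indicator_def)
    show "(\<integral>\<^sup>+z. ratio z * indicator E z \<partial>prod_law) - (\<integral>\<^sup>+z. of_nat M * indicator E z \<partial>prod_law) =
        emeasure joint E - of_nat M * emeasure prod_law E"
      using emeasure_density[of ratio prod_law E]
      by (simp add: density_ratio nn_integral_cmult_indicator)
  qed auto
  \<comment> \<open>Subtraction in \<open>ennreal\<close> is truncated at 0, so domination makes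
    this difference vanish.\<close>
  also have "\<dots> = 0" using joint_le_prod_law[OF E] by (simp add: diff_eq_0_iff_ennreal less_top[symmetric])
  finally have "AE z in prod_law. ratio z * indicator E z - of_nat M * indicator E z = 0"
    by (subst (asm) nn_integral_0_iff_AE) auto
  then show ?thesis
    using AE_space
  proof eventually_elim
    case (elim z)
    then show ?case
      by (cases "of_nat M < ratio z") (auto simp: E_def diff_eq_0_iff_ennreal)
  qed
qed

text \<open>A density is nonzero almost everywhere with respect to the measure it defines; the bound
  by \<open>M\<close> passes from the product law to the joint law because null sets do.\<close>

lemma AE_joint_ratio: "AE z in joint. 0 < ratio z \<and> ratio z \<le> of_nat M"
  using AE_ratio_le
  by (subst density_ratio[symmetric], subst AE_density) auto

text \<open>The alphabet need not separate points: instead of the singleton of a codeword one has to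
  use a measurable set that contains only codewords inseparable from it.\<close>

lemma codeword_atom:
  assumes m: "m < M"
  obtains G where "G \<in> sets X" "x m \<in> G"
    "\<And>k h. k < M \<Longrightarrow> x k \<in> G \<Longrightarrow> h \<in> borel_measurable X \<Longrightarrow> h (x k) = (h (x m) :: ennreal)"
proof -
  \<comment> \<open>If some measurable set separates \<open>x m\<close> from \<open>x k\<close>,
    then it or its complement contains \<open>x m\<close> and misses \<open>x k\<close>; otherwise
    the whole space serves. The desired set is the intersection over all messages.\<close>
  have "\<exists>G\<in>sets X. x m \<in> G \<and> ((\<exists>E\<in>sets X. (x m \<in> E) \<noteq> (x k \<in> E)) \<longrightarrow> x k \<notin> G)" for k
  proof (cases "\<exists>E\<in>sets X. (x m \<in> E) \<noteq> (x k \<in> E)")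
    case True
    then obtain E where E: "E \<in> sets X" "(x m \<in> E) \<noteq> (x k \<in> E)" by blast
    show ?thesis
    proof (cases "x m \<in> E")
      case True
      then show ?thesis using E by blast
    next
      case False
      then show ?thesis using E x[OF m] by (intro bexI[of _ "space X - E"]) auto
    qed
  next
    case False
    then show ?thesis using x[OF m] by (intro bexI[of _ "space X"]) auto
  qed
  then obtain G where G: "\<And>k. G k \<in> sets X" "\<And>k. x m \<in> G k"
      "\<And>k E. E \<in> sets X \<Longrightarrow> (x m \<in> E) \<noteq> (x k \<in> E) \<Longrightarrow> x k \<notin> G k"
    by metis
  show thesis
  proof (rule that[of "\<Inter>k<M. G k"])
    show "(\<Inter>k<M. G k) \<in> sets X" using M_pos G(1) by (intro sets.finite_INT) auto
    show "x m \<in> (\<Inter>k<M. G k)" using G(2) by auto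
  next
    fix k and h :: "'x \<Rightarrow> ennreal"
    assume k: "k < M" "x k \<in> (\<Inter>k<M. G k)" and h[measurable]: "h \<in> borel_measurable X"
    \<comment> \<open>The level set of \<open>h\<close> through \<open>x m\<close> is measurable. If
      \<open>x k\<close> lay outside it, the two codewords would be separable and \<open>x k\<close>
      would not belong to \<open>G k\<close>.\<close>
    let ?E = "{z \<in> space X. h z = h (x m)}"
    have "?E \<in> sets X" by measurable
    then have "x k \<in> ?E" using G(3)[of ?E k] k x[OF m] by blast
    then show "h (x k) = h (x m)" by simp
  qed
qed

text \<open>Since the set \<open>G\<close> around a codeword has positive input mass, the joint
  density gives the conditional density at every codeword, not just at almost every input. Both
  descriptions of the joint law, evaluated on \<open>G \<times> F\<close>, produce the same factor
  \<open>c\<close>, because the codewords in \<open>G\<close> cannot be told apart by measurable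
  functions.\<close>

lemma emeasure_K_ratio:
  assumes m: "m < M" and F [measurable]: "F \<in> sets Y"
  shows "emeasure (K (x m)) F = (\<integral>\<^sup>+y. ratio (x m, y) * indicator F y \<partial>out_law)"
proof -
  obtain G where G[measurable]: "G \<in> sets X" and xG: "x m \<in> G"
    and eq: "\<And>k h. k < M \<Longrightarrow> x k \<in> G \<Longrightarrow> h \<in> borel_measurable X \<Longrightarrow> h (x k) = (h (x m) :: ennreal)"
    using codeword_atom[OF m] by metis
  define I where "I = {k. k < M \<and> x k \<in> G}"
  define c where "c = (\<Sum>k\<in>I. ennreal (1 / M))"
  define b where "b = (\<integral>\<^sup>+y. ratio (x m, y) * indicator F y \<partial>out_law)"
  have I: "finite I" "m \<in> I" "I \<subseteq> {..<M}" using m xG by (auto simp: I_def)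
  \<comment> \<open>\<open>c\<close> is the input mass of \<open>G\<close>; being positive and
    finite, it can be cancelled at the end.\<close>
  have c: "c \<noteq> 0" "c \<noteq> \<infinity>" using I M_pos by (auto simp: c_def ennreal_mult_eq_top_iff)
  have GF: "G \<times> F \<in> sets (X \<Otimes>\<^sub>M Y)" by measurable
  have "emeasure joint (G \<times> F) = c * emeasure (K (x m)) F"
  proof -
    have "emeasure joint (G \<times> F) =
        (\<Sum>k<M. if k \<in> I then ennreal (1 / M) * emeasure (K (x k)) F else 0)"
      unfolding emeasure_joint[OF GF] by (rule sum.cong) (auto simp: I_def vimage_def)
    also have "\<dots> = (\<Sum>k\<in>I. ennreal (1 / M) * emeasure (K (x k)) F)"
      using I by (simp add: sum.If_cases Int_absorb1)
    also have "\<dots> = (\<Sum>k\<in>I. ennreal (1 / M) * emeasure (K (x m)) F)"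
      using eq[OF _ _ emeasure_K_measurable[OF F]] by (intro sum.cong) (auto simp: I_def)
    finally show ?thesis unfolding c_def sum_distrib_right .
  qed
  moreover have "emeasure joint (G \<times> F) = c * b"
  proof -
    have "emeasure joint (G \<times> F) = (\<integral>\<^sup>+z. ratio z * indicator (G \<times> F) z \<partial>prod_law)"
      by (subst density_ratio[symmetric], subst emeasure_density) auto
    also have "\<dots> = (\<Sum>k<M. ennreal (1 / M) *
        (\<integral>\<^sup>+y. ratio (x k, y) * indicator (G \<times> F) (x k, y) \<partial>out_law))"
      by (rule nn_integral_prod_law) measurable
    also have "\<dots> = (\<Sum>k<M. if k \<in> I then ennreal (1 / M) *
        (\<integral>\<^sup>+y. ratio (x k, y) * indicator F y \<partial>out_law) else 0)"
      by (intro sum.cong refl)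
        (auto simp: I_def indicator_def intro!: arg_cong2[where f = "(*)"] nn_integral_cong)
    also have "\<dots> = (\<Sum>k\<in>I. ennreal (1 / M) * (\<integral>\<^sup>+y. ratio (x k, y) * indicator F y \<partial>out_law))"
      using I by (simp add: sum.If_cases Int_absorb1)
    also have "\<dots> = (\<Sum>k\<in>I. ennreal (1 / M) * b)"
    proof (intro sum.cong refl arg_cong2[where f = "(*)"])
      fix k assume k: "k \<in> I"
      \<comment> \<open>Integrating out \<open>y\<close> leaves a measurable function of the input,
        hence one with equal values at all codewords in \<open>G\<close>.\<close>
      have "(\<lambda>z. \<integral>\<^sup>+y. ratio (z, y) * indicator F y \<partial>out_law) \<in> borel_measurable X"
        by measurable
      from eq[OF _ _ this, of k] k
      show "(\<integral>\<^sup>+y. ratio (x k, y) * indicator F y \<partial>out_law) = b"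
        by (simp add: I_def b_def)
    qed
    finally show ?thesis unfolding c_def sum_distrib_right .
  qed
  ultimately show ?thesis using c
    by (simp add: b_def ennreal_mult_cancel_left)
qed

section \<open>Tails of the information density\<close>

lemma dens_le: "AE z in joint. dens z \<le> ln M"
  using AE_joint_ratio
proof eventually_elim
  case (elim z)
  then show ?case using M_pos
    by (cases "ratio z")
      (auto simp: info_density_def ennreal_of_nat_eq_real_of_nat)
qed

text \<open>Each section of the low-density event is split by the decision region. The part outside
  is charged to the error; inside, the bound on the ratio replaces the conditional law by
  \<open>c\<close> times the output law of \<open>D m\<close>.\<close>

lemma prob_dens_le:
  assumes D: "\<And>m. m < M \<Longrightarrow> D m \<in> sets Y" "disjoint_family_on D {..<M}"
  shows "measure joint {z \<in> space joint. dens z \<le> ln M - \<gamma>} \<le>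
    (\<Sum>m<M. measure (K (x m)) (space Y - D m)) / M + exp (- \<gamma>)"
proof -
  \<comment> \<open>Exponentiating \<open>ln M - \<gamma>\<close> gives the corresponding threshold
    for the ratio.\<close>
  define c where "c = real M * exp (- \<gamma>)"
  have c: "c > 0" "ln c = ln M - \<gamma>" using M_pos by (auto simp: c_def ln_mult)
  define E where "E = {z \<in> space (X \<Otimes>\<^sub>M Y). ratio z \<le> ennreal c}"
  have E [measurable]: "E \<in> sets (X \<Otimes>\<^sub>M Y)" unfolding E_def by measurable
  \<comment> \<open>An infinite ratio would have \<open>dens z = 0\<close> without lying in
    \<open>E\<close>; such points are null for the joint law.\<close>
  have "AE z in joint. dens z \<le> ln M - \<gamma> \<longrightarrow> z \<in> E"
    using AE_joint_ratio AE_space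
  proof eventually_elim
    case (elim z)
    then show ?case using c
      by (cases "ratio z")
        (auto simp: E_def info_density_def ennreal_of_nat_eq_real_of_nat top_unique
          simp flip: c(2))
  qed
  then have "measure joint {z \<in> space joint. dens z \<le> ln M - \<gamma>} \<le> measure joint E"
    by (intro joint.finite_measure_mono_AE) auto
  also have "\<dots> = (\<Sum>m<M. measure (K (x m)) (Pair (x m) -` E)) / M"
    by (rule measure_joint[OF E])
  also have "\<dots> \<le> (\<Sum>m<M. measure (K (x m)) (space Y - D m) + c * measure out_law (D m)) / M"
  proof (intro divide_right_mono sum_mono)
    fix m assume "m \<in> {..<M}"
    then have m: "m < M" by simp
    interpret K: prob_space "K (x m)" using prob_space_K[OF x[OF m]] .
    note sK = sets_K[OF x[OF m]]
    note [measurable] = D(1)[OF m]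
    define F where "F = Pair (x m) -` E \<inter> D m"
    have E1: "Pair (x m) -` E \<in> sets Y" by (rule sets_Pair1[OF E])
    have F: "F \<in> sets Y" using E1 D(1)[OF m] by (auto simp: F_def)
    have "emeasure (K (x m)) F \<le> (\<integral>\<^sup>+y. ennreal c * indicator (D m) y \<partial>out_law)"
      unfolding emeasure_K_ratio[OF m F]
      by (intro nn_integral_mono) (auto simp: F_def E_def indicator_def)
    also have "\<dots> = ennreal c * emeasure out_law (D m)"
      by (simp add: nn_integral_cmult_indicator)
    finally have F_le: "measure (K (x m)) F \<le> c * measure out_law (D m)"
      using c by (simp add: K.emeasure_eq_measure out_law.emeasure_eq_measure flip: ennreal_mult)
    have "measure (K (x m)) (Pair (x m) -` E) \<le> measure (K (x m)) ((space Y - D m) \<union> F)"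
      using sets.sets_into_space[OF E1] F D(1)[OF m] sK
      by (intro K.finite_measure_mono) (auto simp: F_def)
    also have "\<dots> \<le> measure (K (x m)) (space Y - D m) + measure (K (x m)) F"
      using F D(1)[OF m] sK by (intro measure_Un_le) auto
    finally show "measure (K (x m)) (Pair (x m) -` E) \<le>
        measure (K (x m)) (space Y - D m) + c * measure out_law (D m)"
      using F_le by simp
  qed simp
  \<comment> \<open>The factor \<open>M\<close> inside \<open>c\<close> cancels the averaging factor
    \<open>1 / M\<close>.\<close>
  also have "\<dots> = (\<Sum>m<M. measure (K (x m)) (space Y - D m)) / M +
      exp (- \<gamma>) * (\<Sum>m<M. measure out_law (D m))"
    using M_pos by (simp add: c_def sum.distrib add_divide_distrib flip: sum_distrib_left)
  \<comment> \<open>By disjointness the \<open>M\<close> output probabilities add up to at most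
    1.\<close>
  also have "(\<Sum>m<M. measure out_law (D m)) = measure out_law (\<Union>m<M. D m)"
    using D by (intro out_law.finite_measure_finite_Union[symmetric]) auto
  also have "exp (- \<gamma>) * measure out_law (\<Union>m<M. D m) \<le> exp (- \<gamma>)"
    by (intro mult_left_le out_law.prob_le_1) simp
  finally show ?thesis by simp
qed

section \<open>Integrability of the information density and bounds on the mutual information\<close>

text \<open>Under the product law the integrand becomes \<open>r * max 0 (- ln r)\<close> with
  \<open>r\<close> the ratio, which is at most 1 pointwise since
  \<open>ln (1 / r) \<le> 1 / r\<close>.\<close>

lemma nn_integral_neg_dens: "(\<integral>\<^sup>+z. ennreal (max 0 (- dens z)) \<partial>joint) \<le> 1"
proof -
  have "(\<integral>\<^sup>+z. ennreal (max 0 (- dens z)) \<partial>joint) =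
      (\<integral>\<^sup>+z. ratio z * ennreal (max 0 (- dens z)) \<partial>prod_law)"
    using nn_integral_density[of ratio prod_law "\<lambda>z. ennreal (max 0 (- dens z))"]
    by (simp add: density_ratio)
  also have "\<dots> \<le> (\<integral>\<^sup>+z. 1 \<partial>prod_law)"
  proof (rule nn_integral_mono)
    fix z
    show "ratio z * ennreal (max 0 (- dens z)) \<le> 1"
    proof (cases "ratio z")
      case (real r)
      have "r * max 0 (- ln r) \<le> 1"
      proof (cases "r > 0")
        case True
        have "ln (1 / r) \<le> 1 / r"
          using ln_le_minus_one[of "1 / r"] True by simp
        then have "max 0 (- ln r) \<le> 1 / r" using True by (simp add: ln_div)
        then show ?thesis using True by (simp add: field_simps)
      qed (use real in simp)
      then have "ennreal (r * max 0 (- ln r)) \<le> 1" by simp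
      then show ?thesis using real
        by (simp add: info_density_def ennreal_mult)
    \<comment> \<open>For an infinite ratio \<open>enn2real\<close> and \<open>ln\<close> both
      return 0, so the product is 0.\<close>
    qed (simp add: info_density_def)
  qed
  also have "\<dots> = 1" by (simp add: prod_law.emeasure_space_1 del: space_prod_law)
  finally show ?thesis .
qed

lemma
  shows integrable_neg_dens: "integrable joint (\<lambda>z. max 0 (- dens z))"
    and integral_neg_dens: "(\<integral>z. max 0 (- dens z) \<partial>joint) \<le> 1"
proof -
  show int: "integrable joint (\<lambda>z. max 0 (- dens z))"
    using le_less_trans[OF nn_integral_neg_dens]
    by (intro integrableI_nonneg) auto
  show "(\<integral>z. max 0 (- dens z) \<partial>joint) \<le> 1"
    using nn_integral_neg_dens by (subst (asm) nn_integral_eq_integral[OF int]) auto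
qed

text \<open>The bound \<open>ln M\<close> controls the positive part,
  \<open>integrable_neg_dens\<close> the negative part.\<close>

lemma integrable_dens: "integrable joint dens"
proof (rule Bochner_Integration.integrable_bound)
  show "integrable joint (\<lambda>z. ln M + max 0 (- dens z))"
    using integrable_neg_dens by simp
  show "AE z in joint. norm (dens z) \<le> norm (ln M + max 0 (- dens z))"
    using dens_le by eventually_elim (use M_pos in \<open>simp add: abs_le_iff max_def\<close>)
qed simp

lemma mutual_info_le: "mutual_info in_law K \<le> ln M"
proof -
  have "mutual_info in_law K \<le> (\<integral>z. ln M \<partial>joint)"
    unfolding mutual_info_def by (intro integral_mono_AE integrable_dens dens_le) simp
  then show ?thesis by (simp add: joint.prob_space del: space_joint)
qed

text \<open>The gap \<open>ln M - dens z\<close> is below \<open>\<gamma>\<close> off the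
  low-density event, and on it at most \<open>ln M\<close> plus the negative part. The unbounded
  lower tail thus enters only through the mean of the negative part, which costs at most 1.\<close>

lemma mutual_info_ge:
  assumes "\<gamma> \<ge> 0"
  shows "ln M - mutual_info in_law K \<le>
    \<gamma> + ln M * measure joint {z \<in> space joint. dens z \<le> ln M - \<gamma>} + 1"
proof -
  define E where "E = {z \<in> space joint. dens z \<le> ln M - \<gamma>}"
  have E [measurable]: "E \<in> sets joint" unfolding E_def by measurable
  have intE: "integrable joint (indicator E :: _ \<Rightarrow> real)"
    using E by (intro integrable_real_indicator) (simp_all add: less_top[symmetric])
  have M0: "ln M \<ge> 0" using M_pos by simp
  have "ln M - mutual_info in_law K = (\<integral>z. ln M - dens z \<partial>joint)"
    using integrable_dens
    by (simp add: mutual_info_def joint.prob_space del: space_joint)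
  also have "\<dots> \<le> (\<integral>z. \<gamma> + ln M * indicator E z + max 0 (- dens z) \<partial>joint)"
  proof (rule integral_mono_AE)
    show "integrable joint (\<lambda>z. ln M - dens z)" using integrable_dens by simp
    show "integrable joint (\<lambda>z. \<gamma> + ln M * indicator E z + max 0 (- dens z))"
      using integrable_neg_dens intE by simp
    show "AE z in joint. ln M - dens z \<le> \<gamma> + ln M * indicator E z + max 0 (- dens z)"
      using AE_space by eventually_elim (use M0 assms in \<open>auto simp: E_def indicator_def max_def\<close>)
  qed
  also have "\<dots> = \<gamma> + ln M * measure joint E + (\<integral>z. max 0 (- dens z) \<partial>joint)"
    using integrable_neg_dens intE
    by (simp add: joint.prob_space Int_absorb2 sets.sets_into_space[OF E] del: space_joint)
  also have "\<dots> \<le> \<gamma> + ln M * measure joint E + 1" using integral_neg_dens by simp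
  finally show ?thesis unfolding E_def .
qed

end

section \<open>Error probabilities and the bounds for codes\<close>

lemma message_error_le_1:
  assumes "prob_space (K s (codeword C m))"
  shows "message_error K C s m \<le> 1"
  using prob_space.prob_le_1[OF assms] by (simp add: message_error_def)

text \<open>Reduces both error criteria to the average one.\<close>

lemma state_error_average_le:
  assumes "num_codewords C \<ge> 1"
  shows "state_error Average_Error K C s \<le> state_error crit K C s"
proof (cases crit)
  case Maximum_Error
  have "(\<Sum>m<num_codewords C. message_error K C s m) \<le>
      real (card {..<num_codewords C}) * (MAX m\<in>{..<num_codewords C}. message_error K C s m)"
    by (rule sum_bounded_above) auto
  then show ?thesis using assms Maximum_Error by (simp add: divide_le_eq mult.commute)
qed simp

text \<open>Gives the boundedness over the states that a real supremum requires.\<close>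

lemma state_error_le_1:
  assumes C: "num_codewords C \<ge> 1"
    and K: "\<And>m. m < num_codewords C \<Longrightarrow> prob_space (K s (codeword C m))"
  shows "state_error crit K C s \<le> 1"
proof -
  have *: "message_error K C s m \<le> 1" if "m < num_codewords C" for m
    using K[OF that] by (rule message_error_le_1)
  show ?thesis
  proof (cases crit)
    case Maximum_Error
    then show ?thesis using C * by (auto simp: lessThan_empty_iff)
  next
    case Average_Error
    have "(\<Sum>m<num_codewords C. message_error K C s m) \<le> real (card {..<num_codewords C}) * 1"
      using * by (intro sum_bounded_above) auto
    then show ?thesis using C Average_Error by (simp add: divide_le_eq)
  qed
qed

text \<open>The suprema over \<open>S\<close> are taken in \<^typ>\<open>real\<close>, where they are junk for unbounded families.\<close>

lemma
  assumes "compound_channel A B S W" "is_code A B S n C" "n > 0" "s \<in> S"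
  shows uniform_input_code:
      "uniform_input (words A n) (words B n) (num_codewords C) (codeword C) (W n s)"
    and average_error_le_compound_error:
      "state_error Average_Error (W n) C s \<le> compound_error crit S (W n) C"
proof -
  have *: "uniform_input (words A n) (words B n) (num_codewords C) (codeword C) (W n s)"
    if "s \<in> S" for s
    using assms that by unfold_locales (auto simp: compound_channel_def is_code_def)
  then show "uniform_input (words A n) (words B n) (num_codewords C) (codeword C) (W n s)"
    using assms by simp
  have C: "num_codewords C \<ge> 1" using assms by (simp add: is_code_def)
  have "bdd_above ((\<lambda>s. state_error crit (W n) C s) ` S)"
    using uniform_input.prob_space_K[OF *] uniform_input.x[OF *]
    by (intro bdd_aboveI2[where M = 1] state_error_le_1[OF C]) auto
  then have "state_error crit (W n) C s \<le> compound_error crit S (W n) C"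
    unfolding compound_error_def using assms by (intro cSUP_upper)
  then show "state_error Average_Error (W n) C s \<le> compound_error crit S (W n) C"
    using state_error_average_le[OF C, of "W n" s crit] by linarith
qed

text \<open>Carries the locale results over to a code. The bounds contain only the number of
  codewords and the compound error, so they are uniform in \<open>s\<close>.\<close>

lemma code_bounds:
  fixes C :: "('s, 'a, 'b) block_code"
  assumes "compound_channel A B S W" "is_code A B S n C" "n > 0" "s \<in> S"
  defines "P \<equiv> code_input A n C"
  defines "J \<equiv> joint_law P (W n s)" and "i \<equiv> info_density P (W n s)"
  shows prob_space_joint_law_code: "prob_space J"
    and info_density_measurable_code: "i \<in> borel_measurable J"
    and integrable_info_density_code: "integrable J i"
    and info_density_le_code: "AE z in J. i z \<le> ln (num_codewords C)"
    and prob_info_density_le_code: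
      "measure J {z \<in> space J. i z \<le> ln (num_codewords C) - \<gamma>} \<le>
        compound_error crit S (W n) C + exp (- \<gamma>)"
    and mutual_info_le_code: "mutual_info P (W n s) \<le> ln (num_codewords C)"
    and mutual_info_ge_code: "\<gamma> \<ge> 0 \<Longrightarrow> ln (num_codewords C) - mutual_info P (W n s) \<le>
      \<gamma> + ln (num_codewords C) * (compound_error crit S (W n) C + exp (- \<gamma>)) + 1"
proof -
  interpret uniform_input "words A n" "words B n" "num_codewords C" "codeword C" "W n s"
    by (rule uniform_input_code[OF assms(1-4)])
  have P: "P = in_law" by (simp add: P_def code_input_def in_law_def)
  have D: "decision_region C s m \<in> sets (words B n)" if "m < num_codewords C" for m
    using assms(2,4) that by (auto simp: is_code_def)
  have disj: "disjoint_family_on (decision_region C s) {..<num_codewords C}"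
    using assms(2,4) by (auto simp: is_code_def)
  \<comment> \<open>The error term of \<open>prob_dens_le\<close> is exactly the average error in
    state \<open>s\<close>.\<close>
  have err: "(\<Sum>m<num_codewords C. measure (W n s (codeword C m))
        (space (words B n) - decision_region C s m)) / num_codewords C =
      state_error Average_Error (W n) C s"
    using space_K[OF x] by (simp add: message_error_def)
  have le: "measure J {z \<in> space J. i z \<le> ln (num_codewords C) - \<gamma>} \<le>
      compound_error crit S (W n) C + exp (- \<gamma>)" for \<gamma>
    using prob_dens_le[OF D disj, of \<gamma>]
      average_error_le_compound_error[OF assms(1-4), of crit]
    unfolding err J_def i_def P by linarith
  then show "measure J {z \<in> space J. i z \<le> ln (num_codewords C) - \<gamma>} \<le>
      compound_error crit S (W n) C + exp (- \<gamma>)" .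
  show "prob_space J" "integrable J i" "AE z in J. i z \<le> ln (num_codewords C)"
    "i \<in> borel_measurable J" "mutual_info P (W n s) \<le> ln (num_codewords C)"
    unfolding J_def i_def P
    using joint.prob_space_axioms integrable_dens dens_le mutual_info_le by auto
  show "ln (num_codewords C) - mutual_info P (W n s) \<le>
      \<gamma> + ln (num_codewords C) * (compound_error crit S (W n) C + exp (- \<gamma>)) + 1" if "\<gamma> \<ge> 0"
    using mutual_info_ge[OF that] M_pos
      mult_left_mono[OF le[of \<gamma>], of "ln (num_codewords C)"]
    unfolding J_def i_def P by simp
qed

text \<open>With the rate within \<open>\<delta> / 2\<close> of \<open>R\<close>, an upward
  deviation by more than \<open>\<delta>\<close> would contradict the bound \<open>ln M\<close>,
  with \<open>M\<close> the number of codewords. A downward one puts the density at least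
  \<open>\<delta> / 2 * n\<close> below \<open>ln M\<close>, which is the choice of
  \<open>\<gamma>\<close>.\<close>

lemma info_density_prob_deviation:
  assumes "compound_channel A B S W" "is_code A B S n (C n)" "n > 0" "s \<in> S"
    and \<delta>: "\<bar>code_rate n (C n) - R\<bar> \<le> \<delta> / 2" "\<delta> > 0"
  shows "info_density_prob (\<lambda>n. code_input A n (C n)) W n s (\<lambda>Z. \<bar>Z - R\<bar> > \<delta>) \<le>
    compound_error crit S (W n) (C n) + exp (- (\<delta> / 2 * n))"
proof -
  let ?L = "ln (num_codewords (C n))" and ?P = "code_input A n (C n)"
  let ?J = "joint_law ?P (W n s)" and ?i = "info_density ?P (W n s)"
  interpret prob_space ?J by (rule prob_space_joint_law_code[OF assms(1-4)])
  note [measurable] = info_density_measurable_code[OF assms(1-4)]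
  have L: "\<bar>?L - R * n\<bar> \<le> \<delta> / 2 * n"
    using \<delta> \<open>n > 0\<close> by (simp add: code_rate_def field_simps abs_le_iff)
  have "info_density_prob (\<lambda>n. code_input A n (C n)) W n s (\<lambda>Z. \<bar>Z - R\<bar> > \<delta>) \<le>
      measure ?J {z \<in> space ?J. ?i z \<le> ?L - \<delta> / 2 * n}"
    unfolding info_density_prob_def
  proof (rule finite_measure_mono_AE)
    show "AE z in ?J. z \<in> {z \<in> space ?J. \<delta> < \<bar>?i z / n - R\<bar>} \<longrightarrow>
        z \<in> {z \<in> space ?J. ?i z \<le> ?L - \<delta> / 2 * n}"
      using info_density_le_code[OF assms(1-4)]
    proof eventually_elim
      case (elim z)
      have "\<delta> * n < \<bar>?i z - R * n\<bar>" if "\<delta> < \<bar>?i z / n - R\<bar>"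
      proof -
        have "\<bar>?i z - R * n\<bar> = \<bar>?i z / n - R\<bar> * n"
          using \<open>n > 0\<close> by (simp add: abs_mult_pos left_diff_distrib)
        then show ?thesis using that \<open>n > 0\<close> by simp
      qed
      moreover have "\<delta> * n > 0" using \<delta> \<open>n > 0\<close> by simp
      ultimately have "?i z \<le> ?L - \<delta> / 2 * n" if "\<delta> < \<bar>?i z / n - R\<bar>"
        using that elim L by linarith
      then show ?case by blast
    qed
  qed measurable
  also have "\<dots> \<le> compound_error crit S (W n) (C n) + exp (- (\<delta> / 2 * n))"
    by (rule prob_info_density_le_code[OF assms(1-4)])
  finally show ?thesis .
qed

section \<open>Information rates from uniform convergence in probability\<close>

text \<open>A threshold on one side of \<open>R\<close> makes the tail event a deviation from
  \<open>R\<close>, so its probability vanishes. On the other side the complement is a deviation, so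
  the probability tends to 1 instead.\<close>

lemma info_rates_eq:
  fixes P :: "nat \<Rightarrow> 'x measure" and W :: "nat \<Rightarrow> 's \<Rightarrow> 'x \<Rightarrow> 'y measure" and R :: real
  assumes S: "S \<noteq> {}"
    and prob: "\<And>n s. n > 0 \<Longrightarrow> s \<in> S \<Longrightarrow> prob_space (joint_law (P n) (W n s))"
    and meas: "\<And>n s. n > 0 \<Longrightarrow> s \<in> S \<Longrightarrow>
      info_density (P n) (W n s) \<in> borel_measurable (joint_law (P n) (W n s))"
    and lim: "\<And>\<delta>. \<delta> > 0 \<Longrightarrow>
      (\<lambda>n. SUP s\<in>S. info_density_prob P W n s (\<lambda>Z. \<bar>Z - R\<bar> > \<delta>)) \<longlonglongrightarrow> 0"
  shows "inf_info_rate S P W = ereal R" and "sup_info_rate S P W = ereal R"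
proof -
  define F where "F n Q = (SUP s\<in>S. info_density_prob P W n s Q)" for n Q
  have le_1: "info_density_prob P W n s Q \<le> 1" if "n > 0" "s \<in> S" for n s Q
    unfolding info_density_prob_def by (rule prob_space.prob_le_1[OF prob[OF that]])
  have upper: "info_density_prob P W n s Q \<le> F n Q" if "n > 0" "s \<in> S" for n s Q
    unfolding F_def using that le_1 by (intro cSUP_upper bdd_aboveI2[where M = 1])
  have nonneg: "0 \<le> F n Q" if n: "n > 0" for n Q
  proof -
    obtain s where "s \<in> S" using S by auto
    from upper[OF n this, of Q] show ?thesis
      by (rule order_trans[rotated]) (simp add: info_density_prob_def)
  qed
  have to_0: "(\<lambda>n. F n Q) \<longlonglongrightarrow> 0"
    if "\<delta> > 0" and Q: "\<And>Z. Q Z \<Longrightarrow> \<delta> < \<bar>Z - R\<bar>" for Q \<delta>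
  proof (rule tendsto_sandwich[OF _ _ tendsto_const])
    show "(\<lambda>n. F n (\<lambda>Z. \<delta> < \<bar>Z - R\<bar>)) \<longlonglongrightarrow> 0"
      unfolding F_def by (rule lim) fact
    show "\<forall>\<^sub>F n in sequentially. 0 \<le> F n Q"
      using eventually_gt_at_top[of 0] by eventually_elim (rule nonneg)
    show "\<forall>\<^sub>F n in sequentially. F n Q \<le> F n (\<lambda>Z. \<delta> < \<bar>Z - R\<bar>)"
      using eventually_gt_at_top[of 0]
    proof eventually_elim
      case n: (elim n)
      show ?case unfolding F_def[of n Q]
      proof (rule cSUP_least[OF S])
        fix s assume s: "s \<in> S"
        interpret prob_space "joint_law (P n) (W n s)" by (rule prob[OF n s])
        note [measurable] = meas[OF n s]
        have "info_density_prob P W n s Q \<le> info_density_prob P W n s (\<lambda>Z. \<delta> < \<bar>Z - R\<bar>)"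
          unfolding info_density_prob_def using Q by (intro finite_measure_mono) auto
        then show "info_density_prob P W n s Q \<le> F n (\<lambda>Z. \<delta> < \<bar>Z - R\<bar>)"
          using upper[OF n s] by (rule order_trans)
      qed
    qed
  qed
  \<comment> \<open>The event \<open>Q\<close> and the deviation event cover the whole space, so in
    any state their probabilities add up to at least 1 and cannot both vanish.\<close>
  have not_to_0: "\<not> (\<lambda>n. F n Q) \<longlonglongrightarrow> 0"
    if "\<delta> > 0" and Q: "\<And>Z. \<not> Q Z \<Longrightarrow> \<delta> < \<bar>Z - R\<bar>"
      and [measurable]: "Measurable.pred borel Q" for Q \<delta>
  proof
    assume "(\<lambda>n. F n Q) \<longlonglongrightarrow> 0"
    from tendsto_add[OF this to_0[OF \<open>\<delta> > 0\<close>, of "\<lambda>Z. \<delta> < \<bar>Z - R\<bar>"]]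
    have "(\<lambda>n. F n Q + F n (\<lambda>Z. \<delta> < \<bar>Z - R\<bar>)) \<longlonglongrightarrow> 0" by simp
    moreover have "\<forall>\<^sub>F n in sequentially. 1 \<le> F n Q + F n (\<lambda>Z. \<delta> < \<bar>Z - R\<bar>)"
      using eventually_gt_at_top[of 0]
    proof eventually_elim
      case n: (elim n)
      obtain s where s: "s \<in> S" using S by auto
      let ?J = "joint_law (P n) (W n s)"
      interpret prob_space ?J by (rule prob[OF n s])
      note [measurable] = meas[OF n s]
      let ?E = "\<lambda>Q. {z \<in> space ?J. Q (info_density (P n) (W n s) z / n)}"
      have "1 = measure ?J (space ?J)" by (simp add: prob_space)
      also have "\<dots> \<le> measure ?J (?E Q \<union> ?E (\<lambda>Z. \<delta> < \<bar>Z - R\<bar>))"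
        using Q by (intro finite_measure_mono) auto
      also have "\<dots> \<le> measure ?J (?E Q) + measure ?J (?E (\<lambda>Z. \<delta> < \<bar>Z - R\<bar>))"
        by (intro measure_Un_le) measurable
      also have "\<dots> \<le> F n Q + F n (\<lambda>Z. \<delta> < \<bar>Z - R\<bar>)"
        using upper[OF n s] unfolding info_density_prob_def by (intro add_mono)
      finally show ?case .
    qed
    ultimately have "(1::real) \<le> 0" by (intro tendsto_lowerbound) auto
    then show False by simp
  qed
  show "inf_info_rate S P W = ereal R"
  proof (rule antisym)
    show "inf_info_rate S P W \<le> ereal R"
      unfolding inf_info_rate_def F_def[symmetric]
    proof (rule SUP_least, rule ccontr)
      fix r assume r: "r \<in> {r. (\<lambda>n. F n (\<lambda>Z. Z \<le> r)) \<longlonglongrightarrow> 0}" "\<not> ereal r \<le> ereal R"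
      then show False using not_to_0[of "(r - R) / 2" "\<lambda>Z. Z \<le> r"] by auto
    qed
    show "ereal R \<le> inf_info_rate S P W"
    proof (rule dense_le)
      fix y assume "y < ereal R"
      then obtain r where r: "y < ereal r" "r < R"
        by (metis ereal_dense2 less_ereal.simps(1))
      \<comment> \<open>\<open>Z \<le> r\<close> only yields
        \<open>\<bar>Z - R\<bar> \<ge> R - r\<close>; halving the gap makes the inequality
        strict.\<close>
      have "(\<lambda>n. F n (\<lambda>Z. Z \<le> r)) \<longlonglongrightarrow> 0" using r(2) by (intro to_0[of "(R - r) / 2"]) auto
      then have "ereal r \<le> inf_info_rate S P W"
        unfolding inf_info_rate_def F_def by (intro SUP_upper) simp
      then show "y \<le> inf_info_rate S P W" using r(1) by simp
    qed
  qed
  show "sup_info_rate S P W = ereal R"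
  proof (rule antisym)
    show "ereal R \<le> sup_info_rate S P W"
      unfolding sup_info_rate_def F_def[symmetric]
    proof (rule INF_greatest, rule ccontr)
      fix r assume r: "r \<in> {r. (\<lambda>n. F n (\<lambda>Z. Z \<ge> r)) \<longlonglongrightarrow> 0}" "\<not> ereal R \<le> ereal r"
      then show False using not_to_0[of "(R - r) / 2" "\<lambda>Z. Z \<ge> r"] by auto
    qed
    show "sup_info_rate S P W \<le> ereal R"
    proof (rule dense_ge)
      fix y assume "ereal R < y"
      then obtain r where r: "ereal r < y" "R < r"
        by (metis ereal_dense2 less_ereal.simps(1))
      have "(\<lambda>n. F n (\<lambda>Z. Z \<ge> r)) \<longlonglongrightarrow> 0" using r(2) by (intro to_0[of "(r - R) / 2"]) auto
      then have "sup_info_rate S P W \<le> ereal r"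
        unfolding sup_info_rate_def F_def by (intro INF_lower) simp
      then show "sup_info_rate S P W \<le> y" using r(1) by simp
    qed
  qed
qed

section \<open>Limits along a sequence of codes\<close>

theorem theorem4:
  fixes A :: "'a measure" and B :: "'b measure" and S :: "'s set"
    and W :: "nat \<Rightarrow> 's \<Rightarrow> (nat \<Rightarrow> 'a) \<Rightarrow> (nat \<Rightarrow> 'b) measure"
    and C :: "nat \<Rightarrow> ('s, 'a, 'b) block_code"
    and P :: "nat \<Rightarrow> (nat \<Rightarrow> 'a) measure"
    and crit :: error_criterion and R :: real
  assumes "S \<noteq> {}"
    and "compound_channel A B S W"
    and "\<And>n. n > 0 \<Longrightarrow> is_code A B S n (C n)"
    and "(\<lambda>n. compound_error crit S (W n) (C n)) \<longlonglongrightarrow> 0"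
    and "(\<lambda>n. code_rate n (C n)) \<longlonglongrightarrow> R"
    and "P = (\<lambda>n. code_input A n (C n))"
  shows "(\<forall>\<delta>>0. (\<lambda>n. SUP s\<in>S. info_density_prob P W n s (\<lambda>Z. \<bar>Z - R\<bar> > \<delta>)) \<longlonglongrightarrow> 0)
    \<and> inf_info_rate S P W = ereal R
    \<and> sup_info_rate S P W = ereal R
    \<and> (\<forall>s\<in>S. (\<forall>n>0. integrable (joint_law (P n) (W n s)) (info_density (P n) (W n s)))
            \<and> (\<lambda>n. mutual_info (P n) (W n s) / real n) \<longlonglongrightarrow> R)"
proof -
  define e where "e n = compound_error crit S (W n) (C n)" for n
  define r where "r n = code_rate n (C n)" for n
  have e: "e \<longlonglongrightarrow> 0" and r: "r \<longlonglongrightarrow> R"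
    using assms(4,5) by (simp_all add: e_def[abs_def] r_def[abs_def])
  have "(\<lambda>n. SUP s\<in>S. info_density_prob P W n s (\<lambda>Z. \<bar>Z - R\<bar> > \<delta>)) \<longlonglongrightarrow> 0"
    if \<delta>: "\<delta> > 0" for \<delta>
  proof (rule tendsto_sandwich[OF _ _ tendsto_const])
    have "(\<lambda>n. exp (- (\<delta> / 2 * real n))) \<longlonglongrightarrow> 0" using \<delta> by real_asymp
    from tendsto_add[OF e this] show "(\<lambda>n. e n + exp (- (\<delta> / 2 * real n))) \<longlonglongrightarrow> 0" by simp
    have *: "\<forall>\<^sub>F n in sequentially. n > 0 \<and> \<bar>r n - R\<bar> \<le> \<delta> / 2"
      using eventually_gt_at_top[of 0] tendstoD[OF r half_gt_zero[OF \<delta>]]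
      by eventually_elim (simp add: dist_real_def)
    have dev: "info_density_prob P W n s (\<lambda>Z. \<bar>Z - R\<bar> > \<delta>) \<le> e n + exp (- (\<delta> / 2 * real n))"
      if "n > 0 \<and> \<bar>r n - R\<bar> \<le> \<delta> / 2" "s \<in> S" for n s
      unfolding assms(6) e_def using that \<delta> assms(2,3)
      by (intro info_density_prob_deviation[where A = A and B = B]) (auto simp: r_def)
    show "\<forall>\<^sub>F n in sequentially. (SUP s\<in>S. info_density_prob P W n s (\<lambda>Z. \<bar>Z - R\<bar> > \<delta>))
        \<le> e n + exp (- (\<delta> / 2 * real n))"
      using * by eventually_elim (use dev in \<open>intro cSUP_least assms(1)\<close>)
    \<comment> \<open>Any single state witnesses nonnegativity, once \<open>dev\<close> bounds the
      family so that the real supremum is a true upper bound.\<close>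
    show "\<forall>\<^sub>F n in sequentially. 0 \<le> (SUP s\<in>S. info_density_prob P W n s (\<lambda>Z. \<bar>Z - R\<bar> > \<delta>))"
      using *
    proof eventually_elim
      case n: (elim n)
      obtain s where s: "s \<in> S" using assms(1) by auto
      show ?case
        by (rule cSUP_upper2[OF bdd_aboveI2[OF dev[OF n]] s]) (auto simp: info_density_prob_def)
    qed
  qed
  note conv = this
  have rates: "inf_info_rate S P W = ereal R" "sup_info_rate S P W = ereal R"
    using info_rates_eq[OF assms(1) _ _ conv]
      prob_space_joint_law_code[OF assms(2,3)] info_density_measurable_code[OF assms(2,3)]
    unfolding assms(6) by blast+
  have "(\<lambda>n. mutual_info (P n) (W n s) / real n) \<longlonglongrightarrow> R" if s: "s \<in> S" for s
  proof (rule tendsto_sandwich[OF _ _ _ r])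
    \<comment> \<open>This is \<open>mutual_info_ge_code\<close> with
      \<open>\<gamma> = sqrt n\<close>, divided by \<open>n\<close>: the choice grows slowly enough
      for \<open>\<gamma> / n\<close> to vanish, yet \<open>exp (- \<gamma>)\<close> vanishes too.
      The middle term vanishes because \<open>r\<close> converges.\<close>
    let ?l = "\<lambda>n. r n - (sqrt n / n + r n * (e n + exp (- sqrt n)) + 1 / n)"
    have "(\<lambda>n::nat. sqrt n / n) \<longlonglongrightarrow> 0" "(\<lambda>n::nat. exp (- sqrt n)) \<longlonglongrightarrow> 0"
        "(\<lambda>n::nat. 1 / real n) \<longlonglongrightarrow> 0" by real_asymp+
    then have "?l \<longlonglongrightarrow> R - (0 + R * (0 + 0) + 0)"
      by (intro tendsto_intros e r)
    then show "?l \<longlonglongrightarrow> R" by simp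
    show "\<forall>\<^sub>F n in sequentially. ?l n \<le> mutual_info (P n) (W n s) / n"
      using eventually_gt_at_top[of 0]
    proof eventually_elim
      case n: (elim n)
      let ?L = "ln (num_codewords (C n))"
      have "?L - mutual_info (P n) (W n s) \<le> sqrt n + ?L * (e n + exp (- sqrt n)) + 1"
        unfolding assms(6) e_def
        by (rule mutual_info_ge_code[OF assms(2) assms(3)[OF n] n s]) simp
      from divide_right_mono[OF this, of "real n"] show ?case
        by (simp add: r_def code_rate_def diff_divide_distrib add_divide_distrib)
    qed
    show "\<forall>\<^sub>F n in sequentially. mutual_info (P n) (W n s) / n \<le> r n"
      using eventually_gt_at_top[of 0]
    proof eventually_elim
      case n: (elim n)
      show ?case unfolding assms(6) r_def code_rate_def
        by (intro divide_right_mono mutual_info_le_code[OF assms(2) assms(3)[OF n] n s]) simp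
    qed
  qed
  moreover have "integrable (joint_law (P n) (W n s)) (info_density (P n) (W n s))"
    if "n > 0" "s \<in> S" for n s
    unfolding assms(6) by (rule integrable_info_density_code[OF assms(2) assms(3)[OF that(1)] that])
  ultimately show ?thesis using conv rates by blast
qed

end
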